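(* For $p>0$ let $$\omega(p)=\left[\frac pe\Big(\Gamma(p)-\int_0^1t^{p-1}e^t\,dt\Big)+1\right]^{1/p}.$$ Let $\varphi_0(t)=\log(1/t)$, $t\in(0,1)$. Then, with respect to $A_\infty((0,1))$, $$\varepsilon_{\varphi_0}=1,\qquad\varepsilon_{-\varphi_0}=\infty.$$ If $p\ge1$, then $$\|\varphi_0\|_{\mathrm{BMO}^p((0,1))}=\omega(p).$$ Consequently, for $p\ge1$, $$\varepsilon_0(p)\le\omega(p)\qquad\text{and}\qquad C(\varepsilon,p)\ge\frac{e^{-\varepsilon/\omega(p)}}{1-\varepsilon/\omega(p)},\quad0\le\varepsilon<\omega(p),$$ where $\varepsilon_0(p)$ and $C(\varepsilon,p)$ are the John--Nirenberg constant of $\mathrm{BMO}^p((0,1))$ and the best constant in the integral John--Nirenberg inequality defined in the context.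
   Context: For an interval $J$, $\langle\varphi\rangle_J=\frac1{|J|}\int_J\varphi$. For an interval $Q$ and $p>0$, $\|\varphi\|_{\mathrm{BMO}^p(Q)}=\sup_{J\subset Q}\langle|\varphi-\langle\varphi\rangle_J|^p\rangle_J^{1/p}$, the supremum being over all subintervals $J$ of $Q$; $\mathrm{BMO}(Q)$ is the set of locally integrable $\varphi$ for which this is finite (the set is the same for all $p>0$). An a.e. positive function $w$ is in $A_\infty(Q)$ if $w$ and $\log w$ are locally integrable and $[w]_{A_\infty(Q)}:=\sup_{J\subset Q}\langle w\rangle_Je^{-\langle\log w\rangle_J}<\infty$ (supremum over subintervals $J$ of $Q$). For $\varphi\in\mathrm{BMO}(Q)$, $\varepsilon_\varphi=\sup\{\varepsilon>0:\ e^{\varepsilon\varphi}\in A_\infty(Q)\}\in(0,\infty]$. For $p>0$ and $\varepsilon\ge0$ let $C(\varepsilon,p)\in[1,\infty]$ be the smallest constant such that $\langle e^\varphi\rangle_J\le C(\varepsilon,p)\,e^{\langle\varphi\rangle_J}$ for every $\varphi\in\mathrm{BMO}((0,1))$ with $\|\varphi\|_{\mathrm{BMO}^p((0,1))}\le\varepsilon$ and every subinterval $J\subset(0,1)$. The John--Nirenberg constant $\varepsilon_0(p)$ is the largest number such that $C(\varepsilon,p)<\infty$ for all $0\le\varepsilon<\varepsilon_0(p)$. *)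

theory Defs
  imports "HOL-Analysis.Analysis"
begin

text \<open>
  The intervals over which averages are taken: bounded and nondegenerate, with or without
  their endpoints.
\<close>

definition subintervals :: "real set \<Rightarrow> real set set" where
  "subintervals Q = {J. is_interval J \<and> bounded J \<and> interior J \<noteq> {} \<and> J \<subseteq> Q}"

definition locally_integrable :: "real set \<Rightarrow> (real \<Rightarrow> real) \<Rightarrow> bool" where
  "locally_integrable Q f \<longleftrightarrow> (\<forall>K. compact K \<and> K \<subseteq> Q \<longrightarrow> f absolutely_integrable_on K)"

definition avg :: "real set \<Rightarrow> (real \<Rightarrow> real) \<Rightarrow> real" where
  "avg J f = (LINT x:J|lebesgue. f x) / measure lebesgue J"

text \<open>The average of a nonnegative function, which may be infinite.\<close>

definition eavg :: "real set \<Rightarrow> (real \<Rightarrow> real) \<Rightarrow> ennreal" where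
  "eavg J f = (\<integral>\<^sup>+x\<in>J. ennreal (f x) \<partial>lebesgue) / emeasure lebesgue J"

text \<open>Powers with a positive exponent, extended by the value \<open>\<infinity>\<close> at \<open>\<infinity>\<close>.\<close>

definition epowr :: "ennreal \<Rightarrow> real \<Rightarrow> ennreal" where
  "epowr x a = (if x = \<infinity> then \<infinity> else ennreal (enn2real x powr a))"

text \<open>
  A locally integrable function need not be integrable over a subinterval that reaches an
  endpoint of \<open>Q\<close>. The suprema below take the value \<open>\<infinity>\<close> as soon as the average of
  \<open>\<phi>\<close>, respectively of \<open>ln w\<close>, over some subinterval is not finite. In the second case this is
  forced: \<open>\<langle>ln w\<rangle> = -\<infinity>\<close> makes \<open>exp (- \<langle>ln w\<rangle>)\<close> infinite, and otherwise
  \<open>\<langle>w\<rangle>\<close> is infinite because \<open>ln w \<le> w\<close>.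
\<close>

definition bmo_norm :: "real \<Rightarrow> real set \<Rightarrow> (real \<Rightarrow> real) \<Rightarrow> ennreal" where
  "bmo_norm p Q \<phi> = (SUP J\<in>subintervals Q.
     if \<phi> absolutely_integrable_on J
     then epowr (eavg J (\<lambda>x. \<bar>\<phi> x - avg J \<phi>\<bar> powr p)) (1 / p) else \<infinity>)"

text \<open>The set \<open>BMO p Q\<close> does not depend on \<open>p > 0\<close>.\<close>

definition BMO :: "real \<Rightarrow> real set \<Rightarrow> (real \<Rightarrow> real) set" where
  "BMO p Q = {\<phi>. locally_integrable Q \<phi> \<and> bmo_norm p Q \<phi> < \<infinity>}"

definition Ainf_const :: "real set \<Rightarrow> (real \<Rightarrow> real) \<Rightarrow> ennreal" where
  "Ainf_const Q w = (SUP J\<in>subintervals Q.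
     if (\<lambda>x. ln (w x)) absolutely_integrable_on J
     then eavg J w * ennreal (exp (- avg J (\<lambda>x. ln (w x)))) else \<infinity>)"

definition Ainf :: "real set \<Rightarrow> (real \<Rightarrow> real) set" where
  "Ainf Q = {w. (AE x in lebesgue. x \<in> Q \<longrightarrow> 0 < w x) \<and> locally_integrable Q w \<and>
     locally_integrable Q (\<lambda>x. ln (w x)) \<and> Ainf_const Q w < \<infinity>}"

definition eps_crit :: "real set \<Rightarrow> (real \<Rightarrow> real) \<Rightarrow> ennreal" where
  "eps_crit Q \<phi> = Sup {ennreal \<epsilon> |\<epsilon>. 0 < \<epsilon> \<and> (\<lambda>x. exp (\<epsilon> * \<phi> x)) \<in> Ainf Q}"

text \<open>The constants admissible in the integral John--Nirenberg inequality on \<open>(0, 1)\<close>.\<close>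

definition JN_admissible :: "real \<Rightarrow> real \<Rightarrow> ennreal \<Rightarrow> bool" where
  "JN_admissible \<epsilon> p C \<longleftrightarrow>
     (\<forall>\<phi>\<in>BMO p {0<..<1}. bmo_norm p {0<..<1} \<phi> \<le> ennreal \<epsilon> \<longrightarrow>
        (\<forall>J\<in>subintervals {0<..<1}.
           eavg J (\<lambda>x. exp (\<phi> x)) \<le> C * ennreal (exp (avg J \<phi>))))"

definition JN_C :: "real \<Rightarrow> real \<Rightarrow> ennreal" where
  "JN_C \<epsilon> p = Inf {C. JN_admissible \<epsilon> p C}"

definition JN_eps0 :: "real \<Rightarrow> ennreal" where
  "JN_eps0 p = Sup {a. \<forall>\<epsilon>\<ge>0. ennreal \<epsilon> < a \<longrightarrow> JN_C \<epsilon> p < \<infinity>}"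

text \<open>The infimum and the supremum are attained: the smallest constant and the largest number exist.\<close>

lemma JN_admissible_JN_C: "JN_admissible \<epsilon> p (JN_C \<epsilon> p)"
proof -
  have iff: "x \<le> C * ennreal (exp r) \<longleftrightarrow> x * ennreal (exp (- r)) \<le> C" for x C :: ennreal and r :: real
  proof -
    have 1: "ennreal (exp r) * ennreal (exp (- r)) = 1"
      by (simp flip: ennreal_mult exp_add)
    show ?thesis
    proof
      assume "x \<le> C * ennreal (exp r)"
      then have "x * ennreal (exp (- r)) \<le> C * ennreal (exp r) * ennreal (exp (- r))"
        by (rule mult_right_mono) simp
      then show "x * ennreal (exp (- r)) \<le> C"
        by (simp add: mult.assoc 1)
    next
      assume "x * ennreal (exp (- r)) \<le> C"
      then have "x * ennreal (exp (- r)) * ennreal (exp r) \<le> C * ennreal (exp r)"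
        by (rule mult_right_mono) simp
      then show "x \<le> C * ennreal (exp r)"
        using 1 by (simp add: mult.assoc mult.commute[of "ennreal (exp (- r))"])
    qed
  qed
  show ?thesis
    unfolding JN_C_def JN_admissible_def iff by (auto intro!: Inf_greatest)
qed

lemma JN_C_le: "JN_admissible \<epsilon> p C \<Longrightarrow> JN_C \<epsilon> p \<le> C"
  unfolding JN_C_def by (auto intro: Inf_lower)

lemma JN_C_less_top: "0 \<le> \<epsilon> \<Longrightarrow> ennreal \<epsilon> < JN_eps0 p \<Longrightarrow> JN_C \<epsilon> p < \<infinity>"
  unfolding JN_eps0_def less_Sup_iff by blast

definition phi0 :: "real \<Rightarrow> real" where
  "phi0 t = ln (1 / t)"

definition omega :: "real \<Rightarrow> real" where
  "omega p = (p / exp 1 * (Gamma p - integral {0..1} (\<lambda>t. t powr (p - 1) * exp t)) + 1) powr (1 / p)"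

end

theory Submission
  imports Defs "HOL-Real_Asymp.Real_Asymp"
begin

text \<open>
  On \<open>(0, b)\<close> the function \<open>\<phi>\<^sub>0\<close> minus its average is distributed like \<open>Y - 1\<close> with \<open>Y\<close>
  exponential, whose \<open>p\<close>-th absolute moment is \<open>\<omega>(p)\<^sup>p\<close>. On \<open>(a, b)\<close> it is distributed like a
  centred truncated exponential variable, and the two densities cross exactly twice. Having equal
  means, they are comparable in the convex order, so intervals ending at \<open>0\<close> are extremal for every
  \<open>p \<ge> 1\<close>. The bounds on \<open>\<epsilon>\<^sub>0(p)\<close> and \<open>C(\<epsilon>, p)\<close> come from testing the John--Nirenberg inequality with
  \<open>(\<epsilon> / \<omega>(p)) \<phi>\<^sub>0\<close> on \<open>(0, 1)\<close>, where \<open>\<langle>exp (s \<phi>\<^sub>0)\<rangle> = 1 / (1 - s)\<close> for \<open>s < 1\<close> and \<open>\<infinity>\<close> for \<open>s \<ge> 1\<close>.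
\<close>

section \<open>Convexity of powers and chords of convex functions\<close>

lemma convex_on_abs_powr:
  fixes p :: real
  assumes p: "p \<ge> 1"
  shows "convex_on UNIV (\<lambda>x::real. \<bar>x\<bar> powr p)"
proof (rule convex_onI)
  fix t x y :: real
  assume t: "0 < t" "t < 1"
  \<comment> \<open>This serves the case where one of the two points is 0; otherwise both are
    positive and convexity of the power on the positive axis applies.\<close>
  have aux: "(s * z) powr p \<le> s * z powr p" if "0 < s" "s < 1" "0 \<le> z" for s z :: real
  proof -
    have "s powr p \<le> s powr 1"
      using that p by (intro powr_mono') auto
    then show ?thesis
      using that by (simp add: powr_mult mult_right_mono)
  qed
  have conv: "((1 - t) * u + t * v) powr p \<le> (1 - t) * u powr p + t * v powr p"
    if "0 \<le> u" "0 \<le> v" for u v :: real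
  proof (cases "u = 0 \<or> v = 0")
    case True
    then show ?thesis
      using aux[of "1 - t" u] aux[of t v] that t p by auto
  next
    case False
    then show ?thesis
      using convex_onD[OF powr_convex[OF p], of t u v] that t by auto
  qed
  have "\<bar>(1 - t) * x + t * y\<bar> \<le> (1 - t) * \<bar>x\<bar> + t * \<bar>y\<bar>"
    using t abs_triangle_ineq[of "(1 - t) * x" "t * y"] by (simp add: abs_mult)
  then have "\<bar>(1 - t) * x + t * y\<bar> powr p \<le> ((1 - t) * \<bar>x\<bar> + t * \<bar>y\<bar>) powr p"
    using p by (intro powr_mono2) auto
  also have "\<dots> \<le> (1 - t) * \<bar>x\<bar> powr p + t * \<bar>y\<bar> powr p"
    by (rule conv) auto
  finally show "\<bar>(1 - t) *\<^sub>R x + t *\<^sub>R y\<bar> powr p \<le> (1 - t) * \<bar>x\<bar> powr p + t * \<bar>y\<bar> powr p"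
    by simp
qed simp

lemma convex_on_abs_diff_powr:
  fixes p c :: real
  assumes "p \<ge> 1"
  shows "convex_on UNIV (\<lambda>x::real. \<bar>x - c\<bar> powr p)"
proof (rule convex_onI)
  fix t x y :: real
  assume t: "0 < t" "t < 1"
  have "(1 - t) * x + t * y - c = (1 - t) * (x - c) + t * (y - c)"
    by (simp add: algebra_simps)
  then show "\<bar>(1 - t) *\<^sub>R x + t *\<^sub>R y - c\<bar> powr p \<le> (1 - t) * \<bar>x - c\<bar> powr p + t * \<bar>y - c\<bar> powr p"
    using convex_onD[OF convex_on_abs_powr[OF assms], of t "x - c" "y - c"] t by simp
qed simp

text \<open>The endpoint of \<open>[A, B]\<close> nearest to \<open>s\<close> lies between
  \<open>s\<close> and the other endpoint. Convexity at that middle point, solved for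
  \<open>h s\<close>, is the claim.\<close>

lemma convex_on_ge_chord_outside:
  fixes h :: "real \<Rightarrow> real"
  assumes h: "convex_on UNIV h" and AB: "A < B" and s: "s \<le> A \<or> B \<le> s"
  shows "h A + (h B - h A) / (B - A) * (s - A) \<le> h s"
proof -
  have chord: "(v - u) * h z \<le> (v - z) * h u + (z - u) * h v" if "u \<le> z" "z \<le> v" "u < v" for u v z
  proof -
    have "h z \<le> (h v - h u) / (v - u) * (z - u) + h u"
      using that by (intro convex_onD_Icc' convex_on_subset[OF h]) auto
    then have "(v - u) * h z \<le> (v - u) * ((h v - h u) / (v - u) * (z - u) + h u)"
      using that by (intro mult_left_mono) auto
    also have "\<dots> = (v - z) * h u + (z - u) * h v"
      using that by (simp add: field_simps)
    finally show ?thesis .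
  qed
  have "(B - A) * h A + (h B - h A) * (s - A) \<le> (B - A) * h s"
    using s
  proof
    assume "s \<le> A"
    then show ?thesis using chord[of s A B] AB by (simp add: algebra_simps)
  next
    assume "B \<le> s"
    then show ?thesis using chord[of A B s] AB by (simp add: algebra_simps)
  qed
  then show ?thesis
    using AB by (simp add: field_simps)
qed

section \<open>Averages over subintervals of the unit interval\<close>

text \<open>The two inclusions leave only membership of \<open>a\<close> and \<open>b\<close> open,
  a null set, so averages over any \<open>J\<close> reduce to integrals over
  \<open>(a, b)\<close>.\<close>

lemma subinterval_endpoints:
  assumes "J \<in> subintervals {0<..<1}"
  obtains a b where "0 \<le> a" "a < b" "b \<le> 1" "{a<..<b} \<subseteq> J" "J \<subseteq> {a..b}"
proof -
  have J: "is_interval J" "bounded J" "interior J \<noteq> {}" "J \<subseteq> {0<..<1}"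
    using assms by (auto simp: subintervals_def)
  then have bdd: "bdd_above J" "bdd_below J" and ne: "J \<noteq> {}"
    using interior_subset by (auto simp: bounded_imp_bdd_above bounded_imp_bdd_below)
  obtain x e where xe: "0 < e" "ball x e \<subseteq> J"
    using J(3) by (auto simp: mem_interior)
  have x: "x \<in> J" "x + e / 2 \<in> J"
    using xe by (auto simp: subset_iff dist_real_def)
  show ?thesis
  proof (rule that)
    show "0 \<le> Inf J"
      using J(4) ne by (intro cInf_greatest) (auto simp: subset_iff less_imp_le)
    show "Sup J \<le> 1"
      using J(4) ne by (intro cSup_least) (auto simp: subset_iff less_imp_le)
    show "Inf J < Sup J"
      using cInf_lower[OF x(1) bdd(2)] cSup_upper[OF x(2) bdd(1)] xe(1) by linarith
    show "J \<subseteq> {Inf J..Sup J}"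
      using bdd by (auto intro: cInf_lower cSup_upper)
    show "{Inf J<..<Sup J} \<subseteq> J"
    proof
      fix z assume "z \<in> {Inf J<..<Sup J}"
      then obtain u v where "u \<in> J" "u < z" "v \<in> J" "z < v"
        using ne bdd by (auto simp: cInf_less_iff less_cSup_iff)
      then show "z \<in> J"
        using J(1) unfolding is_interval_1 by (meson less_imp_le)
    qed
  qed
qed

lemma greaterThanLessThan_subinterval:
  "0 \<le> a \<Longrightarrow> a < b \<Longrightarrow> b \<le> 1 \<Longrightarrow> {a<..<b} \<in> subintervals {0<..<1::real}"
  by (auto simp: subintervals_def is_interval_convex)

lemma nn_integral_eq_ennreal_integral:
  fixes f :: "real \<Rightarrow> real"
  assumes "f absolutely_integrable_on S" "\<And>x. 0 \<le> f x"
  shows "(\<integral>\<^sup>+x\<in>S. ennreal (f x) \<partial>lebesgue) = ennreal (integral S f)"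
proof -
  have "(\<integral>\<^sup>+x\<in>S. ennreal (f x) \<partial>lebesgue) = (\<integral>\<^sup>+x. ennreal (indicator S x *\<^sub>R f x) \<partial>lebesgue)"
    by (intro nn_integral_cong) (auto simp: indicator_def)
  also have "\<dots> = ennreal (LINT x:S|lebesgue. f x)"
    using assms unfolding set_lebesgue_integral_def set_integrable_def
    by (intro nn_integral_eq_integral) auto
  also have "\<dots> = ennreal (integral S f)"
    using assms by (simp add: set_lebesgue_integral_eq_integral)
  finally show ?thesis .
qed

context
  fixes J :: "real set" and a b :: real
  assumes ab: "a < b" and J: "{a<..<b} \<subseteq> J" "J \<subseteq> {a..b}"
begin

lemma negligible_subset_interval_ends: "T \<subseteq> {a..b} - {a<..<b} \<Longrightarrow> negligible T"
  by (rule negligible_subset[of "{a, b}"]) auto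

lemma interval_absolutely_integrable_iff:
  "f absolutely_integrable_on J \<longleftrightarrow> f absolutely_integrable_on {a<..<b}" for f :: "real \<Rightarrow> real"
  using J by (intro absolutely_integrable_spike_set_eq negligible_subset_interval_ends) auto

lemma interval_integral_eq:
  "integral J f = integral {a<..<b} f" for f :: "real \<Rightarrow> real"
  using J by (intro integral_spike_set negligible_subset_interval_ends) auto

lemma interval_lmeasurable: "J \<in> lmeasurable"
proof -
  have "J = {a<..<b} \<union> (J - {a<..<b})"
    using J by auto
  moreover have "negligible (J - {a<..<b})"
    using J by (intro negligible_subset_interval_ends) auto
  ultimately show ?thesis
    by (metis fmeasurable.Un lmeasurable_interval(2) negligible_imp_measurable)
qed

lemma interval_measure: "measure lebesgue J = b - a"
proof -
  have "((\<lambda>_. 1::real) has_integral (b - a)) {a<..<b}"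
    using has_integral_const_real[of "1::real" a b] ab by (simp add: has_integral_Icc_iff_Ioo)
  then show ?thesis
    by (simp add: lmeasure_integral interval_lmeasurable interval_integral_eq integral_unique)
qed

lemma interval_avg:
  assumes "f absolutely_integrable_on {a<..<b}"
  shows "avg J f = integral {a<..<b} f / (b - a)"
  using assms
  by (simp add: avg_def set_lebesgue_integral_eq_integral(2) interval_absolutely_integrable_iff
      interval_measure interval_integral_eq)

lemma interval_eavg:
  assumes "f absolutely_integrable_on {a<..<b}" "\<And>x. 0 \<le> f x"
  shows "eavg J f = ennreal (integral {a<..<b} f / (b - a))"
proof -
  have "emeasure lebesgue J = ennreal (b - a)"
    using interval_lmeasurable by (simp add: emeasure_eq_measure2 interval_measure)
  moreover have "0 \<le> integral {a<..<b} f"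
    using assms by (intro integral_nonneg) (auto simp: absolutely_integrable_on_def)
  ultimately show ?thesis
    using assms ab
    by (simp add: eavg_def nn_integral_eq_ennreal_integral interval_absolutely_integrable_iff
        interval_integral_eq divide_ennreal)
qed

end

lemma locally_integrable_unit_interval:
  "f absolutely_integrable_on {0<..<1} \<Longrightarrow> locally_integrable {0<..<1} f"
  by (auto simp: locally_integrable_def intro: set_integrable_subset dest!: lmeasurable_compact fmeasurableD)

section \<open>Integrals of \<open>phi0\<close> and of its exponentials\<close>

text \<open>Continuity at 0 lets the primitive \<open>x - x * ln x\<close> of \<open>- ln x\<close>
  be used on intervals that start at 0.\<close>

lemma continuous_on_times_ln: "continuous_on {0..} (\<lambda>x::real. x * ln x)"
proof -
  have "((\<lambda>x::real. x * ln x) \<longlongrightarrow> 0) (at_right 0)"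
    by real_asymp
  then have "continuous (at 0 within {0..}) (\<lambda>x::real. x * ln x)"
    by (simp add: continuous_within at_within_Ici_at_right)
  moreover have "continuous (at x within {0..}) (\<lambda>x::real. x * ln x)" if "0 < x" for x
    using that by (intro continuous_intros) auto
  ultimately show ?thesis
    unfolding continuous_on_eq_continuous_within
    by (metis atLeast_iff less_eq_real_def)
qed

lemma phi0_eq: "0 < t \<Longrightarrow> phi0 t = - ln t"
  by (simp add: phi0_def ln_div)

lemma phi0_has_integral:
  assumes "0 \<le> a" "a < b"
  shows "(phi0 has_integral (b - b * ln b) - (a - a * ln a)) {a<..<b}"
proof -
  have "((\<lambda>t. - ln t) has_integral (b - b * ln b) - (a - a * ln a)) {a..b}"
  proof (rule fundamental_theorem_of_calculus_interior)
    show "continuous_on {a..b} (\<lambda>x. x - x * ln x)"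
      using assms by (intro continuous_intros continuous_on_subset[OF continuous_on_times_ln]) auto
    show "((\<lambda>x. x - x * ln x) has_vector_derivative - ln x) (at x)" if "x \<in> {a<..<b}" for x
      using that assms unfolding has_real_derivative_iff_has_vector_derivative[symmetric]
      by (auto intro!: derivative_eq_intros)
  qed (use assms in auto)
  then have "((\<lambda>t. - ln t) has_integral (b - b * ln b) - (a - a * ln a)) {a<..<b}"
    by (simp add: has_integral_Icc_iff_Ioo)
  then show ?thesis
    by (rule has_integral_eq[rotated]) (use assms in \<open>auto simp: phi0_eq\<close>)
qed

lemma phi0_absolutely_integrable:
  assumes "0 \<le> a" "a < b"
  shows "phi0 absolutely_integrable_on {a<..<b}"
proof -
  have const: "(\<lambda>_. ln b) absolutely_integrable_on {a<..<b}"
    by (intro absolutely_integrable_on_const) (rule lmeasurable_interval(2))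
  \<comment> \<open>On \<open>(a, b)\<close> the sum is \<open>ln (b / t)\<close>, which is
    positive, so integrability already gives absolute integrability.\<close>
  have "(\<lambda>t. phi0 t + ln b) absolutely_integrable_on {a<..<b}"
  proof (rule nonnegative_absolutely_integrable_1)
    show "(\<lambda>t. phi0 t + ln b) integrable_on {a<..<b}"
      using phi0_has_integral[OF assms] const
      by (intro integrable_add) (auto simp: absolutely_integrable_on_def integrable_on_def)
  qed (use assms in \<open>auto simp: phi0_eq\<close>)
  from set_integral_diff(1)[OF this const] show ?thesis
    by simp
qed

lemma scaled_phi0_absolutely_integrable:
  assumes "0 \<le> a" "a < b"
  shows "(\<lambda>t. k * phi0 t) absolutely_integrable_on {a<..<b}"
  using phi0_absolutely_integrable[OF assms] by (rule set_integrable_mult_right)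

text \<open>The integrand is \<open>t powr s\<close>, and the value is the difference of its
  integrals from 0 to \<open>b\<close> and from 0 to \<open>a\<close>. The sign of \<open>s\<close>
  is left free so that exponentials of multiples of both \<open>phi0\<close> and
  \<open>- phi0\<close> are covered.\<close>

lemma exp_phi0_has_integral:
  assumes "s > -1" "0 \<le> a" "a < b"
  shows "((\<lambda>t. exp (- s * phi0 t)) has_integral (b powr (s + 1) - a powr (s + 1)) / (s + 1)) {a<..<b}"
proof -
  have 0: "((\<lambda>t. t powr s) has_integral (b powr (s + 1) / (s + 1))) {0..b}"
    "((\<lambda>t. t powr s) has_integral (a powr (s + 1) / (s + 1))) {0..a}"
    using assms by (auto intro: has_integral_powr_from_0)
  have "(\<lambda>t. t powr s) integrable_on {a..b}"
    using integrable_subinterval_real[OF has_integral_integrable[OF 0(1)]] assms by auto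
  then obtain i where i: "((\<lambda>t. t powr s) has_integral i) {a..b}"
    by (auto simp: integrable_on_def)
  have "a powr (s + 1) / (s + 1) + i = b powr (s + 1) / (s + 1)"
    using has_integral_unique[OF has_integral_combine[OF _ _ 0(2) i] 0(1)] assms by auto
  then have "i = (b powr (s + 1) - a powr (s + 1)) / (s + 1)"
    by (simp add: diff_divide_distrib)
  with i have "((\<lambda>t. t powr s) has_integral (b powr (s + 1) - a powr (s + 1)) / (s + 1)) {a<..<b}"
    by (simp add: has_integral_Icc_iff_Ioo)
  then show ?thesis
    by (rule has_integral_eq[rotated]) (use assms in \<open>auto simp: phi0_eq powr_def\<close>)
qed

lemma exp_phi0_absolutely_integrable:
  assumes "s > -1" "0 \<le> a" "a < b"
  shows "(\<lambda>t. exp (- s * phi0 t)) absolutely_integrable_on {a<..<b}"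
  using exp_phi0_has_integral[OF assms] by (intro nonnegative_absolutely_integrable_1) auto

section \<open>Absolute moments of a centred exponential variable\<close>

text \<open>Integration by parts: the derivative of \<open>t powr p * exp t\<close> is integrated
  over the unit interval. This produces the integral that occurs in \<open>omega\<close>.\<close>

lemma powr_exp_has_integral:
  fixes p :: real
  assumes p: "p \<ge> 1"
  shows "((\<lambda>t. t powr p * exp t) has_integral
           exp 1 - p * integral {0..1} (\<lambda>t. t powr (p - 1) * exp t)) {0..1}"
proof -
  have total: "((\<lambda>t::real. p * (t powr (p - 1) * exp t) + t powr p * exp t) has_integral
      1 powr p * exp 1 - 0 powr p * exp 0) {0..1}"
  proof (rule fundamental_theorem_of_calculus_interior)
    show "continuous_on {0..1} (\<lambda>t. t powr p * exp t)"
      using p by (intro continuous_intros continuous_on_powr') auto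
    show "((\<lambda>t. t powr p * exp t) has_vector_derivative p * (t powr (p - 1) * exp t) + t powr p * exp t) (at t)"
      if "t \<in> {0<..<1}" for t :: real
      using that unfolding has_real_derivative_iff_has_vector_derivative[symmetric]
      by (auto intro!: derivative_eq_intros simp: powr_diff)
  qed simp
  have "(\<lambda>t::real. t powr (p - 1) * exp t) integrable_on {0..1}"
  proof -
    have "(\<lambda>t::real. t powr (p - 1)) integrable_on {0..1}"
      using has_integral_powr_from_0[of "p - 1" 1] p by auto
    then have "(\<lambda>t::real. t powr (p - 1)) absolutely_integrable_on {0..1}"
      by (intro nonnegative_absolutely_integrable_1) auto
    then have "(\<lambda>t::real. exp t * t powr (p - 1)) absolutely_integrable_on {0..1}"
      by (intro absolutely_integrable_bounded_measurable_product_real)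
         (auto intro!: continuous_imp_measurable_on_sets_lebesgue continuous_intros
           compact_imp_bounded compact_continuous_image)
    then show ?thesis
      by (simp add: absolutely_integrable_on_def mult.commute)
  qed
  then have "((\<lambda>t::real. p * (t powr (p - 1) * exp t)) has_integral
      p * integral {0..1} (\<lambda>t. t powr (p - 1) * exp t)) {0..1}"
    by (intro has_integral_mult_right integrable_integral)
  from has_integral_diff[OF total this] show ?thesis
    by simp
qed

text \<open>This is the \<open>p\<close>-th absolute moment of \<open>Y - 1\<close> for a standard
  exponential \<open>Y\<close>, that is, \<open>omega p\<close> before the root is taken.\<close>

definition osc :: "real \<Rightarrow> real" where
  "osc p = p / exp 1 * (Gamma p - integral {0..1} (\<lambda>t. t powr (p - 1) * exp t)) + 1"

text \<open>The range is split at 0. The positive half is the Gamma integral at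
  \<open>p + 1\<close>, equal to \<open>p * Gamma p\<close>; reflection turns the negative half into
  \<open>powr_exp_has_integral\<close>. The factor \<open>exp 1\<close> appears because the density
  of \<open>Y - 1\<close> is \<open>exp (- u - 1)\<close>.\<close>

lemma abs_powr_exp_has_integral:
  fixes p :: real
  assumes p: "p \<ge> 1"
  shows "((\<lambda>u. \<bar>u\<bar> powr p * exp (- u)) has_integral exp 1 * osc p) {-1<..}"
proof -
  let ?I = "integral {0..1} (\<lambda>t. t powr (p - 1) * exp t)"
  have "((\<lambda>u. u powr p / exp u) has_integral p * Gamma p) {0..}"
    using Gamma_integral_real[of "p + 1"] p Gamma_plus1[of p] nonpos_Ints_nonpos[of p] by force
  then have pos: "((\<lambda>u. \<bar>u\<bar> powr p * exp (- u)) has_integral p * Gamma p) {0..}"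
    by (rule has_integral_eq[rotated]) (auto simp: exp_minus field_simps)
  have "((\<lambda>t. \<bar>- t\<bar> powr p * exp (- (- t))) has_integral exp 1 - p * ?I) {0..1}"
    by (rule has_integral_eq[OF _ powr_exp_has_integral[OF p]]) auto
  then have neg: "((\<lambda>u. \<bar>u\<bar> powr p * exp (- u)) has_integral exp 1 - p * ?I) {-1..0}"
    using has_integral_reflect_real[of "\<lambda>u. \<bar>u\<bar> powr p * exp (- u)" _ 0 "-1"] by simp
  have "{-1..0} \<inter> {0::real..} = {0}"
    by auto
  then have "((\<lambda>u. \<bar>u\<bar> powr p * exp (- u)) has_integral (exp 1 - p * ?I) + p * Gamma p) ({-1..0} \<union> {0..})"
    using neg pos by (intro has_integral_Un) auto
  moreover have "exp 1 * osc p = (exp 1 - p * ?I) + p * Gamma p"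
    by (simp add: osc_def field_simps)
  ultimately have "((\<lambda>u. \<bar>u\<bar> powr p * exp (- u)) has_integral exp 1 * osc p) ({-1..0} \<union> {0..})"
    by simp
  then show ?thesis
    by (subst (asm) has_integral_spike_set_eq[where T = "{-1<..}"])
       (auto intro: negligible_subset[of "{-1}"])
qed

lemma osc_pos:
  assumes p: "p \<ge> 1"
  shows "0 < osc p"
proof -
  let ?f = "\<lambda>u::real. \<bar>u\<bar> powr p * exp (- u)"
  \<comment> \<open>On \<open>[1, 2]\<close> the integrand is at least \<open>exp (- 2)\<close>, so
    this piece alone makes the moment positive.\<close>
  have int: "?f integrable_on {1..2}"
    using p by (intro integrable_continuous_real continuous_intros continuous_on_powr') auto
  have "0 < exp (- 2 :: real)"
    by simp
  also have "\<dots> = integral {1..2} (\<lambda>_::real. exp (- 2 :: real))"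
    by simp
  also have "\<dots> \<le> integral {1..2} ?f"
  proof (rule integral_le)
    fix u :: real assume "u \<in> {1..2}"
    then have "1 * exp (- 2) \<le> ?f u"
      using p by (intro mult_mono ge_one_powr_ge_zero) auto
    then show "exp (- 2) \<le> ?f u"
      by simp
  qed (use int in auto)
  also have "\<dots> \<le> exp 1 * osc p"
    by (rule has_integral_subset_le[OF _ integrable_integral[OF int] abs_powr_exp_has_integral[OF p]])
       auto
  finally show ?thesis
    by (simp add: zero_less_mult_iff)
qed

lemma omega_eq: "omega p = osc p powr (1 / p)"
  by (simp add: omega_def osc_def)

lemma omega_pos: "p \<ge> 1 \<Longrightarrow> 0 < omega p"
  using osc_pos[of p] by (simp add: omega_eq)

text \<open>The substitution \<open>t = exp (- u - c)\<close> turns \<open>phi0 t - c\<close> into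
  \<open>u\<close> and \<open>(0, b)\<close> into \<open>(-1, \<infinity>)\<close>. The relation
  between \<open>b\<close> and \<open>c\<close> says that \<open>c = 1 - ln b\<close>, the average
  of \<open>phi0\<close> over \<open>(0, b)\<close>.\<close>

lemma phi0_oscillation_from_0:
  assumes p: "p \<ge> 1" and b: "b = exp (1 - c)"
  shows "(\<lambda>t. \<bar>phi0 t - c\<bar> powr p) absolutely_integrable_on {0<..<b}"
    and "integral {0<..<b} (\<lambda>t. \<bar>phi0 t - c\<bar> powr p) = b * osc p"
proof -
  let ?g = "\<lambda>u. exp (- u - c)" and ?h = "\<lambda>t. \<bar>phi0 t - c\<bar> powr p"
  have img: "?g ` {-1<..} = {0<..<b}"
  proof
    show "?g ` {-1<..} \<subseteq> {0<..<b}"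
      by (auto simp: b)
    show "{0<..<b} \<subseteq> ?g ` {-1<..}"
    proof
      fix t assume t: "t \<in> {0<..<b}"
      then have "ln t < 1 - c"
        using b by (metis exp_gt_zero greaterThanLessThan_iff ln_exp ln_less_cancel_iff)
      then show "t \<in> ?g ` {-1<..}"
        using t by (intro image_eqI[of _ _ "- ln t - c"]) auto
    qed
  qed
  have "((\<lambda>u. exp (- c) * (\<bar>u\<bar> powr p * exp (- u))) has_integral exp (- c) * (exp 1 * osc p)) {-1<..}"
    by (intro has_integral_mult_right abs_powr_exp_has_integral p)
  moreover have "exp (- c) * (exp 1 * osc p) = b * osc p"
    by (simp add: b exp_diff exp_minus divide_inverse)
  moreover have "exp (- c) * (\<bar>u\<bar> powr p * exp (- u)) = \<bar>- ?g u\<bar> * ?h (?g u)" for u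
  proof -
    have "phi0 (?g u) - c = u"
      by (simp add: phi0_eq)
    then show ?thesis
      by (simp add: exp_diff exp_minus field_simps)
  qed
  ultimately have I: "((\<lambda>u. \<bar>- ?g u\<bar> * ?h (?g u)) has_integral b * osc p) {-1<..}"
    by simp
  then have "(\<lambda>u. \<bar>- ?g u\<bar> * ?h (?g u)) absolutely_integrable_on {-1<..}"
    by (intro nonnegative_absolutely_integrable_1) auto
  with I have "(\<lambda>u. \<bar>- ?g u\<bar> * ?h (?g u)) absolutely_integrable_on {-1<..} \<and>
      integral {-1<..} (\<lambda>u. \<bar>- ?g u\<bar> * ?h (?g u)) = b * osc p"
    by (simp add: integral_unique)
  then have "?h absolutely_integrable_on ?g ` {-1<..} \<and> integral (?g ` {-1<..}) ?h = b * osc p"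
    by (subst (asm) has_absolute_integral_change_of_variables_1')
       (auto intro!: derivative_eq_intros inj_onI)
  then show "?h absolutely_integrable_on {0<..<b}" "integral {0<..<b} ?h = b * osc p"
    by (simp_all add: img)
qed

section \<open>Oscillation of \<open>phi0\<close> on an arbitrary subinterval\<close>

text \<open>After multiplication by \<open>b - a\<close> the two bounds become
  \<open>a * ln b - a * ln a \<le> b - a\<close> and \<open>a * ln a \<le> a * ln b\<close>. The
  upper bound is an equality when \<open>a = 0\<close>.\<close>

lemma phi0_avg_bounds:
  assumes "0 \<le> a" "a < b" "c = integral {a<..<b} phi0 / (b - a)"
  shows "- ln b \<le> c" "c \<le> 1 - ln b"
proof -
  have c: "c * (b - a) = (b - b * ln b) - (a - a * ln a)"
    using assms integral_unique[OF phi0_has_integral[OF assms(1,2)]] by simp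
  have "a * ln b - a * ln a \<le> b - a \<and> a * ln a \<le> a * ln b"
  proof (cases "a = 0")
    case False
    with assms have a: "0 < a" by simp
    have "ln (b / a) \<le> b / a - 1"
      using a assms by (intro ln_le_minus_one) auto
    then have "a * ln (b / a) \<le> a * (b / a - 1)"
      using a by (intro mult_left_mono) auto
    moreover have "ln a \<le> ln b"
      using a assms by simp
    ultimately show ?thesis
      using a assms by (simp add: ln_div algebra_simps)
  qed (use assms in simp)
  then have "(- ln b) * (b - a) \<le> c * (b - a)" "c * (b - a) \<le> (1 - ln b) * (b - a)"
    unfolding c by (simp_all add: algebra_simps)
  then show "- ln b \<le> c" "c \<le> 1 - ln b"
    using assms(2) by (simp_all only: mult_le_cancel_right_pos diff_gt_0_iff_gt)
qed

text \<open>The average of an affine function of \<open>phi0\<close> depends on the interval only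
  through the average \<open>c\<close> of \<open>phi0\<close>. Two intervals with the same
  \<open>c\<close> therefore give the same average.\<close>

lemma integral_phi0_affine:
  assumes "0 \<le> a" "a < b" "integral {a<..<b} phi0 = c * (b - a)"
  shows "(\<lambda>t. m + k * (phi0 t - z)) integrable_on {a<..<b}"
    and "integral {a<..<b} (\<lambda>t. m + k * (phi0 t - z)) = (b - a) * (m + k * (c - z))"
proof -
  have const: "((\<lambda>_. x) has_integral x * (b - a)) {a<..<b}" for x :: real
    using has_integral_const_real[of x a b] assms by (simp add: has_integral_Icc_iff_Ioo mult.commute)
  have "(phi0 has_integral c * (b - a)) {a<..<b}"
    using phi0_has_integral[OF assms(1,2)] assms(3) by (simp add: has_integral_iff)
  then have "((\<lambda>t. m + k * (phi0 t - z)) has_integral m * (b - a) + k * (c * (b - a) - z * (b - a))) {a<..<b}"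
    by (intro has_integral_add has_integral_mult_right has_integral_diff const)
  moreover have "m * (b - a) + k * (c * (b - a) - z * (b - a)) = (b - a) * (m + k * (c - z))"
    by (simp add: algebra_simps)
  ultimately show "(\<lambda>t. m + k * (phi0 t - z)) integrable_on {a<..<b}"
    "integral {a<..<b} (\<lambda>t. m + k * (phi0 t - z)) = (b - a) * (m + k * (c - z))"
    by (simp_all add: has_integral_iff)
qed

lemma phi0_oscillation_le:
  assumes p: "p \<ge> 1" and ab: "0 \<le> a" "a < b" and c: "c = integral {a<..<b} phi0 / (b - a)"
  shows "(\<lambda>t. \<bar>phi0 t - c\<bar> powr p) absolutely_integrable_on {a<..<b}"
    and "integral {a<..<b} (\<lambda>t. \<bar>phi0 t - c\<bar> powr p) \<le> (b - a) * osc p"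
proof -
  \<comment> \<open>\<open>(0, b')\<close> contains \<open>(a, b)\<close> and \<open>\<phi>\<^sub>0\<close> has the same average \<open>c\<close> on both. Subtracting from \<open>h\<close> its
    chord over the range of \<open>\<phi>\<^sub>0\<close> on \<open>(a, b)\<close> gives a function \<open>d\<close> that is nonpositive on \<open>(a, b)\<close>
    and nonnegative on the rest of \<open>(0, b')\<close>, so its average can only grow.\<close>
  define h where "h = (\<lambda>s. \<bar>s - c\<bar> powr p)"
  define b' where "b' = exp (1 - c)"
  have hJ': "(\<lambda>t. h (phi0 t)) absolutely_integrable_on {0<..<b'}"
    "integral {0<..<b'} (\<lambda>t. h (phi0 t)) = b' * osc p"
    unfolding h_def using phi0_oscillation_from_0[OF p b'_def] by simp_all
  have "ln b \<le> 1 - c"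
    using phi0_avg_bounds[OF ab c] by simp
  then have b': "b \<le> b'"
    using ab by (metis b'_def exp_le_cancel_iff exp_ln order_le_less_trans)
  have sub: "{a<..<b} \<subseteq> {0<..<b'}"
    using ab b' by auto
  have hJ: "(\<lambda>t. h (phi0 t)) absolutely_integrable_on {a<..<b}"
    by (rule set_integrable_subset[OF hJ'(1) _ sub]) simp
  then show "(\<lambda>t. \<bar>phi0 t - c\<bar> powr p) absolutely_integrable_on {a<..<b}"
    by (simp add: h_def)
  have "integral {a<..<b} (\<lambda>t. h (phi0 t)) \<le> (b - a) * osc p"
  \<comment> \<open>For \<open>a = 0\<close> the range of \<open>phi0\<close> is unbounded and has
    no chord, but then \<open>b' = b\<close> and the moment is known exactly.\<close>
  proof (cases "a = 0")
    case True
    then have "integral {a<..<b} phi0 = b * (1 - ln b)"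
      using integral_unique[OF phi0_has_integral[OF ab]] by (simp add: algebra_simps)
    then have "c = 1 - ln b"
      using True ab c by simp
    then have "b' = b"
      using ab True by (simp add: b'_def)
    then show ?thesis
      using hJ' True by simp
  next
    case False
    with ab have a: "0 < a" by simp
    define A B where "A = - ln b" and "B = - ln a"
    have AB: "A < B"
      using a ab by (simp add: A_def B_def)
    define k where "k = (h B - h A) / (B - A)"
    define l where "l = (\<lambda>t. h A + k * (phi0 t - A))"
    define d where "d = (\<lambda>t. h (phi0 t) - l t)"
    \<comment> \<open>\<open>M\<close> is the average of the chord \<open>l\<close> on both
      intervals, because \<open>phi0\<close> has average \<open>c\<close> on both.\<close>
    define M where "M = h A + k * (c - A)"
    have convex: "convex_on UNIV h"
      unfolding h_def by (rule convex_on_abs_diff_powr[OF p])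
    have "integral {a<..<b} phi0 = c * (b - a)"
      using ab c by simp
    then have lJ: "l integrable_on {a<..<b}" "integral {a<..<b} l = (b - a) * M"
      unfolding l_def M_def by (rule integral_phi0_affine[OF ab])+
    \<comment> \<open>\<open>b' = exp (1 - c)\<close> gives \<open>1 - ln b' = c\<close>, so the
      average over \<open>(0, b')\<close> is \<open>c\<close> as well.\<close>
    have "integral {0<..<b'} phi0 = c * (b' - 0)"
      using integral_unique[OF phi0_has_integral[of 0 b']] by (simp add: b'_def algebra_simps)
    then have lJ': "l integrable_on {0<..<b'}" "integral {0<..<b'} l = (b' - 0) * M"
      unfolding l_def M_def by (rule integral_phi0_affine[rotated 2]; simp add: b'_def)+
    have hi: "(\<lambda>t. h (phi0 t)) integrable_on {a<..<b}" "(\<lambda>t. h (phi0 t)) integrable_on {0<..<b'}"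
      using hJ hJ' by (auto simp: absolutely_integrable_on_def)
    have di: "d integrable_on {a<..<b}" "d integrable_on {0<..<b'}"
      unfolding d_def using hi lJ lJ' by (auto intro: integrable_diff)
    have dJ: "integral {a<..<b} d = integral {a<..<b} (\<lambda>t. h (phi0 t)) - (b - a) * M"
      unfolding d_def using hi lJ by (simp add: integral_diff)
    have dJ': "integral {0<..<b'} d = b' * (osc p - M)"
      unfolding d_def using hi lJ' hJ'(2) by (simp add: integral_diff algebra_simps)
    have d_inside: "d t \<le> 0" if "t \<in> {a<..<b}" for t
    proof -
      have "h (phi0 t) \<le> (h B - h A) / (B - A) * (phi0 t - A) + h A"
        using that a by (intro convex_onD_Icc' convex_on_subset[OF convex]) (auto simp: A_def B_def phi0_eq)
      then show ?thesis
        by (simp add: d_def l_def k_def)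
    qed
    have d_outside: "0 \<le> d t" if "t \<in> {0<..<b'} - {a<..<b}" for t
    proof -
      have "phi0 t \<le> A \<or> B \<le> phi0 t"
        using that a ab by (auto simp: A_def B_def phi0_eq not_less)
      from convex_on_ge_chord_outside[OF convex AB this] show ?thesis
        by (simp add: d_def l_def k_def)
    qed
    have neg: "integral {a<..<b} d \<le> 0"
      using integral_le[OF di(1) integrable_0] d_inside by simp
    have "integral {a<..<b} d = integral {0<..<b'} (\<lambda>t. if t \<in> {a<..<b} then d t else 0)"
      by (simp only: integral_restrict_Int Int_absorb2[OF sub])
    also have "\<dots> \<le> integral {0<..<b'} d"
    proof (rule integral_le)
      show "(\<lambda>t. if t \<in> {a<..<b} then d t else 0) integrable_on {0<..<b'}"
        using di(1) by (simp only: integrable_restrict_Int Int_absorb2[OF sub])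
    qed (use di(2) d_outside in auto)
    finally have le: "integral {a<..<b} d \<le> b' * (osc p - M)"
      by (simp add: dJ')
    \<comment> \<open>Here \<open>osc p - M\<close> is the average of \<open>d\<close> over
      \<open>(0, b')\<close>. If it is nonnegative, the bound \<open>neg\<close> suffices; if it is
      negative, replacing \<open>b'\<close> by the smaller length \<open>b - a\<close> only weakens
      the bound \<open>le\<close>.\<close>
    have "integral {a<..<b} d \<le> (b - a) * (osc p - M)"
    proof (cases "0 \<le> osc p - M")
      case True
      then show ?thesis
        using neg ab by (meson diff_ge_0_iff_ge less_imp_le mult_nonneg_nonneg order_trans)
    next
      case False
      then have "b' * (osc p - M) \<le> (b - a) * (osc p - M)"
        using b' a by (intro mult_right_mono_neg) auto
      with le show ?thesis by simp
    qed
    then show ?thesis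
      unfolding dJ by (simp add: algebra_simps)
  qed
  then show "integral {a<..<b} (\<lambda>t. \<bar>phi0 t - c\<bar> powr p) \<le> (b - a) * osc p"
    by (simp add: h_def)
qed

section \<open>The BMO norm of \<open>phi0\<close>\<close>

lemma epowr_ennreal: "0 \<le> x \<Longrightarrow> epowr (ennreal x) a = ennreal (x powr a)"
  by (simp add: epowr_def)

text \<open>The factor \<open>k\<close> is carried along because the John--Nirenberg inequality is
  later tested on multiples of \<open>phi0\<close>; homogeneity reduces everything to
  \<open>phi0_oscillation_le\<close>.\<close>

lemma bmo_norm_phi0_scaled_le:
  assumes p: "p \<ge> 1" and k: "0 \<le> k"
  shows "bmo_norm p {0<..<1} (\<lambda>t. k * phi0 t) \<le> ennreal (k * omega p)"
  unfolding bmo_norm_def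
proof (rule SUP_least)
  fix J :: "real set" assume "J \<in> subintervals {0<..<1}"
  then obtain a b where ab: "0 \<le> a" "a < b" "b \<le> 1" and J: "{a<..<b} \<subseteq> J" "J \<subseteq> {a..b}"
    by (rule subinterval_endpoints)
  note kint = scaled_phi0_absolutely_integrable[OF ab(1,2), of k]
  define c where "c = integral {a<..<b} phi0 / (b - a)"
  have avg: "avg J (\<lambda>t. k * phi0 t) = k * c"
    using interval_avg[OF ab(2) J kint] by (simp add: c_def)
  have eq: "\<bar>k * phi0 t - avg J (\<lambda>t. k * phi0 t)\<bar> powr p = k powr p * \<bar>phi0 t - c\<bar> powr p" for t
    unfolding avg using k by (simp add: abs_mult powr_mult flip: right_diff_distrib)
  note osc = phi0_oscillation_le[OF p ab(1,2) c_def]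
  have oint: "(\<lambda>t. k powr p * \<bar>phi0 t - c\<bar> powr p) absolutely_integrable_on {a<..<b}"
    using osc(1) by (rule set_integrable_mult_right)
  define I where "I = integral {a<..<b} (\<lambda>t. \<bar>phi0 t - c\<bar> powr p) / (b - a)"
  have I: "0 \<le> I" "I \<le> osc p"
    unfolding I_def using osc ab
    by (auto intro!: divide_nonneg_pos integral_nonneg simp: absolutely_integrable_on_def field_simps)
  have "eavg J (\<lambda>t. \<bar>k * phi0 t - avg J (\<lambda>t. k * phi0 t)\<bar> powr p) = ennreal (k powr p * I)"
    unfolding eq using interval_eavg[OF ab(2) J oint] by (simp add: I_def)
  then have "epowr (eavg J (\<lambda>t. \<bar>k * phi0 t - avg J (\<lambda>t. k * phi0 t)\<bar> powr p)) (1 / p)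
      = ennreal ((k powr p * I) powr (1 / p))"
    using I by (simp add: epowr_ennreal)
  also have "(k powr p * I) powr (1 / p) = k * I powr (1 / p)"
    using I k p by (simp add: powr_mult powr_powr)
  also have "ennreal (k * I powr (1 / p)) \<le> ennreal (k * omega p)"
    unfolding omega_eq using I k p by (intro ennreal_leI mult_left_mono powr_mono2) auto
  finally show "(if (\<lambda>t. k * phi0 t) absolutely_integrable_on J
      then epowr (eavg J (\<lambda>t. \<bar>k * phi0 t - avg J (\<lambda>t. k * phi0 t)\<bar> powr p)) (1 / p) else \<infinity>)
      \<le> ennreal (k * omega p)"
    using kint by (simp add: interval_absolutely_integrable_iff[OF ab(2) J])
qed

lemma unit_interval_subset: "{0<..<1::real} \<subseteq> {0..1}"
  by auto

lemma integral_phi0_unit: "integral {0<..<1} phi0 = 1"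
  using integral_unique[OF phi0_has_integral[of 0 1]] by simp

text \<open>The supremum is attained on \<open>(0, 1)\<close> itself, where the average is 1 and
  \<open>phi0_oscillation_from_0\<close> applies with \<open>b = c = 1\<close>.\<close>

lemma bmo_norm_phi0:
  assumes p: "p \<ge> 1"
  shows "bmo_norm p {0<..<1} phi0 = ennreal (omega p)"
proof (rule antisym)
  show "bmo_norm p {0<..<1} phi0 \<le> ennreal (omega p)"
    using bmo_norm_phi0_scaled_le[OF p, of 1] by simp
  have int: "phi0 absolutely_integrable_on {0<..<1}"
    by (simp add: phi0_absolutely_integrable)
  have "avg {0<..<1} phi0 = 1"
    using interval_avg[OF zero_less_one order_refl unit_interval_subset int] by (simp add: integral_phi0_unit)
  moreover have "eavg {0<..<1} (\<lambda>t. \<bar>phi0 t - 1\<bar> powr p) = ennreal (osc p)"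
    using interval_eavg[OF zero_less_one order_refl unit_interval_subset phi0_oscillation_from_0(1)[OF p, of 1 1]]
      phi0_oscillation_from_0(2)[OF p, of 1 1] by simp
  ultimately have "epowr (eavg {0<..<1} (\<lambda>t. \<bar>phi0 t - avg {0<..<1} phi0\<bar> powr p)) (1 / p) = ennreal (omega p)"
    using osc_pos[OF p] by (simp add: epowr_ennreal omega_eq)
  then show "ennreal (omega p) \<le> bmo_norm p {0<..<1} phi0"
    unfolding bmo_norm_def using int
    by (intro SUP_upper2[OF greaterThanLessThan_subinterval[of 0 1]]) auto
qed

lemma scaled_phi0_in_BMO:
  assumes "p \<ge> 1" "0 \<le> k"
  shows "(\<lambda>t. k * phi0 t) \<in> BMO p {0<..<1}"
proof -
  have "(\<lambda>t. k * phi0 t) absolutely_integrable_on {0<..<1}"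
    by (rule scaled_phi0_absolutely_integrable) auto
  moreover have "bmo_norm p {0<..<1} (\<lambda>t. k * phi0 t) < \<infinity>"
    using bmo_norm_phi0_scaled_le[OF assms] by (rule le_less_trans) simp
  ultimately show ?thesis
    by (simp add: BMO_def locally_integrable_unit_interval)
qed

section \<open>Critical exponents of \<open>phi0\<close> and \<open>- phi0\<close>\<close>

text \<open>The weight is \<open>t powr s\<close>. Its average over \<open>(a, b)\<close> is at most
  \<open>K * b powr s\<close>, and since the average \<open>c\<close> of \<open>phi0\<close> differs
  from \<open>- ln b\<close> by at most 1, the factor \<open>exp (s * c)\<close> is at most
  \<open>exp \<bar>s\<bar> * b powr (- s)\<close>. The powers of \<open>b\<close> cancel.\<close>

lemma exp_phi0_in_Ainf:
  assumes s: "s > -1"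
  shows "(\<lambda>t. exp (- s * phi0 t)) \<in> Ainf {0<..<1}"
proof -
  define K where "K = (if s < 0 then 1 / (s + 1) else 1)"
  have powr_Suc: "x powr (s + 1) = x * exp (s * ln x)" if "0 < x" for x
    using that by (simp add: powr_add) (simp add: powr_def)
  have mean: "integral {a<..<b} (\<lambda>t. exp (- s * phi0 t)) \<le> (b - a) * (K * exp (s * ln b))"
    if ab: "0 \<le> a" "a < b" for a b
  proof (cases "s < 0")
    case True
    \<comment> \<open>For negative \<open>s\<close> the weight decreases, so
      \<open>a powr (s + 1)\<close> is at least \<open>a * b powr s\<close>; the numerator of the
      exact integral is then at most \<open>(b - a) * b powr s\<close>, and its denominator accounts
      for \<open>K\<close>.\<close>
    have "a * exp (s * ln b) \<le> a powr (s + 1)"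
    proof (cases "a = 0")
      case False
      then have "exp (s * ln b) \<le> exp (s * ln a)"
        using True ab by auto
      then show ?thesis
        using False ab powr_Suc[of a] by simp
    qed simp
    moreover have "b powr (s + 1) = b * exp (s * ln b)"
      using ab powr_Suc[of b] by simp
    ultimately have "b powr (s + 1) - a powr (s + 1) \<le> (b - a) * exp (s * ln b)"
      by (simp add: algebra_simps)
    then show ?thesis
      using integral_unique[OF exp_phi0_has_integral[OF s ab]] s True
      by (simp add: K_def divide_right_mono)
  next
    case False
    have "((\<lambda>_. exp (s * ln b)) has_integral (b - a) * exp (s * ln b)) {a<..<b}"
      using has_integral_const_real[of "exp (s * ln b)" a b] ab by (simp add: has_integral_Icc_iff_Ioo)
    then show ?thesis
      using has_integral_le[OF exp_phi0_has_integral[OF s ab]] False ab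
        integral_unique[OF exp_phi0_has_integral[OF s ab]]
      by (auto simp: K_def phi0_eq mult_left_mono)
  qed
  have K: "0 < K"
    using s by (simp add: K_def)
  have int: "(\<lambda>t. - s * phi0 t) absolutely_integrable_on {a<..<b}" if "0 \<le> a" "a < b" for a b
    using that by (rule scaled_phi0_absolutely_integrable)
  have "Ainf_const {0<..<1} (\<lambda>t. exp (- s * phi0 t)) \<le> ennreal (K * exp \<bar>s\<bar>)"
    unfolding Ainf_const_def
  proof (rule SUP_least)
    fix J :: "real set" assume "J \<in> subintervals {0<..<1}"
    then obtain a b where ab: "0 \<le> a" "a < b" "b \<le> 1" and J: "{a<..<b} \<subseteq> J" "J \<subseteq> {a..b}"
      by (rule subinterval_endpoints)
    define c where "c = integral {a<..<b} phi0 / (b - a)"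
    define W where "W = integral {a<..<b} (\<lambda>t. exp (- s * phi0 t)) / (b - a)"
    have W: "eavg J (\<lambda>t. exp (- s * phi0 t)) = ennreal W"
      unfolding W_def by (rule interval_eavg[OF ab(2) J exp_phi0_absolutely_integrable[OF s ab(1,2)]]) simp
    have avg: "avg J (\<lambda>t. - s * phi0 t) = - s * c"
      using interval_avg[OF ab(2) J int[OF ab(1,2)]] by (simp add: c_def)
    have "\<bar>ln b + c\<bar> \<le> 1"
      using phi0_avg_bounds[OF ab(1,2) c_def] by linarith
    then have "\<bar>s\<bar> * \<bar>ln b + c\<bar> \<le> \<bar>s\<bar> * 1"
      by (rule mult_left_mono) simp
    then have "s * (ln b + c) \<le> \<bar>s\<bar>"
      using abs_ge_self[of "s * (ln b + c)"] by (simp add: abs_mult)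
    then have "exp (s * ln b) * exp (s * c) \<le> exp \<bar>s\<bar>"
      by (simp add: distrib_left flip: exp_add)
    then have "K * (exp (s * ln b) * exp (s * c)) \<le> K * exp \<bar>s\<bar>"
      using K by (intro mult_left_mono) auto
    moreover have "W \<le> K * exp (s * ln b)"
      using mean[OF ab(1,2)] ab by (simp add: W_def divide_le_eq mult.commute)
    then have "W * exp (s * c) \<le> K * exp (s * ln b) * exp (s * c)"
      by (rule mult_right_mono) simp
    ultimately have "W * exp (s * c) \<le> K * exp \<bar>s\<bar>"
      by (simp only: mult.assoc)
    then have "ennreal W * ennreal (exp (s * c)) \<le> ennreal (K * exp \<bar>s\<bar>)"
      by (subst ennreal_mult''[symmetric]) (auto intro: ennreal_leI)
    then show "(if (\<lambda>t. ln (exp (- s * phi0 t))) absolutely_integrable_on J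
        then eavg J (\<lambda>t. exp (- s * phi0 t)) * ennreal (exp (- avg J (\<lambda>t. ln (exp (- s * phi0 t)))))
        else \<infinity>) \<le> ennreal (K * exp \<bar>s\<bar>)"
      unfolding ln_exp W avg
      using int[OF ab(1,2)] by (simp add: interval_absolutely_integrable_iff[OF ab(2) J])
  qed
  then have "Ainf_const {0<..<1} (\<lambda>t. exp (- s * phi0 t)) < \<infinity>"
    by (rule le_less_trans) simp
  then show ?thesis
    using int[of 0 1] exp_phi0_absolutely_integrable[OF s, of 0 1]
    by (simp add: Ainf_def locally_integrable_unit_interval)
qed

lemma eavg_exp_phi0:
  assumes "s < 1"
  shows "eavg {0<..<1} (\<lambda>t. exp (s * phi0 t)) = ennreal (1 / (1 - s))"
  using interval_eavg[OF zero_less_one order_refl unit_interval_subset exp_phi0_absolutely_integrable[of "- s" 0 1]]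
    assms integral_unique[OF exp_phi0_has_integral[of "- s" 0 1]]
  by simp

text \<open>Since \<open>phi0\<close> is positive on \<open>(0, 1)\<close>, the average is monotone
  in the exponent. At exponent \<open>1 - 1 / n\<close> it equals \<open>n\<close>, so it exceeds
  every natural number once the exponent reaches 1.\<close>

lemma eavg_exp_phi0_infinite:
  assumes "1 \<le> s"
  shows "eavg {0<..<1} (\<lambda>t. exp (s * phi0 t)) = \<infinity>"
proof -
  have "of_nat n \<le> eavg {0<..<1} (\<lambda>t. exp (s * phi0 t))" if "0 < n" for n :: nat
  proof -
    have "of_nat n = ennreal (1 / (1 - (1 - 1 / real n)))"
      by (simp add: ennreal_of_nat_eq_real_of_nat)
    also have "\<dots> = eavg {0<..<1} (\<lambda>t. exp ((1 - 1 / real n) * phi0 t))"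
      using that by (intro eavg_exp_phi0[symmetric]) simp
    also have "\<dots> \<le> eavg {0<..<1} (\<lambda>t. exp (s * phi0 t))"
      unfolding eavg_def
    proof (intro divide_right_mono_ennreal nn_integral_mono)
      fix t :: real
      have "1 - 1 / real n \<le> s"
        using assms by (smt (verit) divide_nonneg_nonneg of_nat_0_le_iff)
      then have "exp ((1 - 1 / real n) * phi0 t) \<le> exp (s * phi0 t)" if "t \<in> {0<..<1}"
        using that by (simp add: phi0_eq mult_right_mono_neg)
      then show "ennreal (exp ((1 - 1 / real n) * phi0 t)) * indicator {0<..<1} t
          \<le> ennreal (exp (s * phi0 t)) * indicator {0<..<1} t"
        by (auto simp: indicator_def intro: ennreal_leI)
    qed
    finally show ?thesis .
  qed
  note le = this
  show ?thesis
  proof (cases "eavg {0<..<1} (\<lambda>t. exp (s * phi0 t))")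
    case (real r)
    obtain n where "r < real n"
      using reals_Archimedean2 by blast
    then show ?thesis
      using le[of n] real by (simp add: ennreal_of_nat_eq_real_of_nat ennreal_le_iff)
  qed simp
qed

lemma exp_phi0_notin_Ainf:
  assumes "1 \<le> s"
  shows "(\<lambda>t. exp (s * phi0 t)) \<notin> Ainf {0<..<1}"
proof -
  have "(\<lambda>t. s * phi0 t) absolutely_integrable_on {0<..<1}"
    by (rule scaled_phi0_absolutely_integrable) auto
  \<comment> \<open>On the whole interval the logarithm has a finite average, so the infinite
    average of the weight is multiplied by a positive factor.\<close>
  then have "\<infinity> \<le> Ainf_const {0<..<1} (\<lambda>t. exp (s * phi0 t))"
    unfolding Ainf_const_def
    by (intro SUP_upper2[OF greaterThanLessThan_subinterval[of 0 1]])
       (auto simp: eavg_exp_phi0_infinite[OF assms] ennreal_top_mult)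
  then show ?thesis
    by (auto simp: Ainf_def top.extremum_unique)
qed

lemma eps_crit_phi0: "eps_crit {0<..<1} phi0 = 1"
proof -
  have iff: "(\<lambda>t. exp (\<epsilon> * phi0 t)) \<in> Ainf {0<..<1} \<longleftrightarrow> \<epsilon> < 1" for \<epsilon>
    using exp_phi0_in_Ainf[of "- \<epsilon>"] exp_phi0_notin_Ainf[of \<epsilon>] by force
  show ?thesis
    unfolding eps_crit_def iff
  proof (rule antisym)
    show "Sup {ennreal \<epsilon> |\<epsilon>. 0 < \<epsilon> \<and> \<epsilon> < 1} \<le> 1"
      by (rule Sup_least) auto
    show "1 \<le> Sup {ennreal \<epsilon> |\<epsilon>. 0 < \<epsilon> \<and> \<epsilon> < 1}"
    proof (rule dense_le)
      fix x :: ennreal assume "x < 1"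
      then obtain r where r: "x = ennreal r" "0 \<le> r" "r < 1"
        by (cases x) auto
      obtain q where q: "r < q" "q < 1"
        using r dense by blast
      show "x \<le> Sup {ennreal \<epsilon> |\<epsilon>. 0 < \<epsilon> \<and> \<epsilon> < 1}"
        using r q by (intro Sup_upper2[of "ennreal q"]) (auto intro: ennreal_leI)
    qed
  qed
qed

lemma eps_crit_uminus_phi0: "eps_crit {0<..<1} (\<lambda>t. - phi0 t) = \<infinity>"
proof -
  have "(\<lambda>t. exp (\<epsilon> * - phi0 t)) \<in> Ainf {0<..<1}" if "0 < \<epsilon>" for \<epsilon>
    using exp_phi0_in_Ainf[of \<epsilon>] that by simp
  then have le: "ennreal \<epsilon> \<le> eps_crit {0<..<1} (\<lambda>t. - phi0 t)" if "0 < \<epsilon>" for \<epsilon>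
    unfolding eps_crit_def using that by (intro Sup_upper) auto
  show ?thesis
  proof (cases "eps_crit {0<..<1} (\<lambda>t. - phi0 t)")
    case (real r)
    then show ?thesis
      \<comment> \<open>Every positive exponent is admissible, so a finite supremum \<open>r\<close>
        would be exceeded by \<open>r + 1\<close>.\<close>
      using le[of "r + 1"] by (simp add: ennreal_le_iff)
  qed simp
qed

section \<open>Bounds on the John--Nirenberg constants\<close>

lemma avg_scaled_phi0: "avg {0<..<1} (\<lambda>t. k * phi0 t) = k"
proof -
  have "(\<lambda>t. k * phi0 t) absolutely_integrable_on {0<..<1}"
    by (rule scaled_phi0_absolutely_integrable) auto
  from interval_avg[OF zero_less_one order_refl unit_interval_subset this] show ?thesis
    by (simp add: integral_phi0_unit)
qed

text \<open>The scale \<open>\<epsilon> / omega p\<close> brings the norm bound for the multiple of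
  \<open>phi0\<close> to exactly \<open>\<epsilon>\<close>, so that multiple is an allowed test
  function; its average over \<open>(0, 1)\<close> is the scale itself.\<close>

lemma eavg_exp_scaled_phi0_le_JN_C:
  assumes p: "p \<ge> 1" and \<epsilon>: "0 \<le> \<epsilon>"
  shows "eavg {0<..<1} (\<lambda>t. exp (\<epsilon> / omega p * phi0 t)) \<le> JN_C \<epsilon> p * ennreal (exp (\<epsilon> / omega p))"
proof -
  let ?k = "\<epsilon> / omega p"
  have k: "0 \<le> ?k" "?k * omega p = \<epsilon>"
    using \<epsilon> omega_pos[OF p] by auto
  have "eavg {0<..<1} (\<lambda>t. exp (?k * phi0 t))
      \<le> JN_C \<epsilon> p * ennreal (exp (avg {0<..<1} (\<lambda>t. ?k * phi0 t)))"
    using JN_admissible_JN_C[of \<epsilon> p] scaled_phi0_in_BMO[OF p k(1)] bmo_norm_phi0_scaled_le[OF p k(1)]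
      greaterThanLessThan_subinterval[of 0 1]
    unfolding JN_admissible_def k(2) by auto
  then show ?thesis
    by (simp only: avg_scaled_phi0)
qed

lemma JN_eps0_le_omega:
  assumes p: "p \<ge> 1"
  shows "JN_eps0 p \<le> ennreal (omega p)"
proof (rule ccontr)
  assume "\<not> ?thesis"
  \<comment> \<open>If the bound failed, \<open>omega p\<close> would lie strictly below
    \<open>JN_eps0 p\<close>. At that value the test function is \<open>phi0\<close> itself, whose
    exponential has infinite average.\<close>
  then have "JN_C (omega p) p < \<infinity>"
    using omega_pos[OF p] by (intro JN_C_less_top) auto
  then have "JN_C (omega p) p * ennreal (exp 1) < \<infinity>"
    by (simp add: ennreal_mult_less_top)
  moreover have "\<infinity> \<le> JN_C (omega p) p * ennreal (exp 1)"
    using eavg_exp_scaled_phi0_le_JN_C[OF p, of "omega p"] omega_pos[OF p] eavg_exp_phi0_infinite[of 1]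
    by simp
  ultimately show False
    by simp
qed

lemma JN_C_lower_bound:
  assumes p: "p \<ge> 1" and \<epsilon>: "0 \<le> \<epsilon>" "\<epsilon> < omega p"
  shows "ennreal (exp (- (\<epsilon> / omega p)) / (1 - \<epsilon> / omega p)) \<le> JN_C \<epsilon> p"
proof -
  let ?k = "\<epsilon> / omega p"
  have k: "0 \<le> ?k" "?k < 1"
    using \<epsilon> omega_pos[OF p] by auto
  have "ennreal (1 / (1 - ?k)) \<le> JN_C \<epsilon> p * ennreal (exp ?k)"
    using eavg_exp_scaled_phi0_le_JN_C[OF p \<epsilon>(1)] eavg_exp_phi0[OF k(2)] by simp
  then have "ennreal (1 / (1 - ?k)) * ennreal (exp (- ?k)) \<le> JN_C \<epsilon> p * ennreal (exp ?k) * ennreal (exp (- ?k))"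
    by (rule mult_right_mono) simp
  also have "\<dots> = JN_C \<epsilon> p"
    by (simp add: mult.assoc flip: ennreal_mult exp_add)
  finally show ?thesis
    using k by (simp flip: ennreal_mult)
qed

theorem lemma3p2:
  shows "eps_crit {0<..<1} phi0 = 1 \<and>
    eps_crit {0<..<1} (\<lambda>t. - phi0 t) = \<infinity> \<and>
    (\<forall>p\<ge>1. bmo_norm p {0<..<1} phi0 = ennreal (omega p) \<and>
       JN_eps0 p \<le> ennreal (omega p) \<and>
       (\<forall>\<epsilon>. 0 \<le> \<epsilon> \<and> \<epsilon> < omega p \<longrightarrow>
          JN_C \<epsilon> p \<ge> ennreal (exp (- (\<epsilon> / omega p)) / (1 - \<epsilon> / omega p))))"
  by (simp add: eps_crit_phi0 eps_crit_uminus_phi0 bmo_norm_phi0 JN_eps0_le_omega JN_C_lower_bound)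

end
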